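(* Let $f_1$ be a strictly increasing polynomial on $[a,b]$ ($a<b$), of degree $m$, such that $f_1'(x)>0$ for all $x$ in the open interval $(a,b)$. Then there exist an integer $n_0\ge m$ and a constant $K>0$ such that for all $n\ge n_0$ and all $0\le k\le n$, $$\left|a+\frac{k}{n}(b-a)-t_{n,k}\right|\le\frac{K}{n},$$ where $t_{n,k}=f_1^{-1}(\gamma_{n,k})$ (in particular $\gamma_{n,k}\in[f_1(a),f_1(b)]$ for such $n$, so that $t_{n,k}\in[a,b]$ is defined), and the $\gamma_{n,k}$ are the Bernstein coordinates of $f_1$ in $\mathbb{P}_n[a,b]$, i.e. $f_1=\sum_{k=0}^n\gamma_{n,k}p_{n,k}$.
   Context: $\mathbb{P}_n[a,b]$ is the space of real polynomials of degree at most $n$ on $[a,b]$, with the standard Bernstein basis $p_{n,k}(x)=\binom{n}{k}\frac{(x-a)^k(b-x)^{n-k}}{(b-a)^n}$, $k=0,\dots,n$. $f_1^{-1}:[f_1(a),f_1(b)]\to[a,b]$ is the inverse of the strictly increasing function $f_1|_{[a,b]}$. *)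

theory Defs
  imports "HOL-Analysis.Analysis" "HOL-Computational_Algebra.Polynomial"
begin

definition bernstein_basis :: "real \<Rightarrow> real \<Rightarrow> nat \<Rightarrow> nat \<Rightarrow> real poly" where
  "bernstein_basis a b n k =
     smult (real (n choose k) / (b - a) ^ n) ([:-a, 1:] ^ k * [:b, -1:] ^ (n - k))"

lemma poly_bernstein_basis:
  "poly (bernstein_basis a b n k) x
     = real (n choose k) * ((x - a) ^ k * (b - x) ^ (n - k) / (b - a) ^ n)"
  by (simp add: bernstein_basis_def)

text \<open>
  The coordinates are a function on all naturals; requiring them to vanish beyond n makes
  the description definite. It is meaningful for a < b and degree f at most n: see
  \<open>ex1_bernstein_coord\<close> and \<open>bernstein_coord_sum\<close> below.
\<close>

definition bernstein_coord :: "real \<Rightarrow> real \<Rightarrow> nat \<Rightarrow> real poly \<Rightarrow> nat \<Rightarrow> real" where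
  "bernstein_coord a b n f =
     (THE c. (\<forall>k>n. c k = 0) \<and> f = (\<Sum>k\<le>n. smult (c k) (bernstein_basis a b n k)))"

lemma scaled_bernstein_exists:
  assumes "a < b" "degree f \<le> n"
  shows "\<exists>c::nat \<Rightarrow> real. f = (\<Sum>k\<le>n. smult (c k) ([:-a, 1:] ^ k * [:b, -1:] ^ (n - k)))"
  using assms(2)
proof (induction n arbitrary: f)
  case 0
  then obtain u where "f = [:u:]" by (auto elim: degree_eq_zeroE)
  then show ?case by (intro exI[of _ "\<lambda>_. u"]) simp
next
  case (Suc n)
  define u where "u = poly f a / (b - a) ^ Suc n"
  define g where "g = f - smult u ([:b, -1:] ^ Suc n)"
  have "poly g a = 0"
    using assms(1) by (simp add: g_def u_def del: power_Suc)
  then obtain h where h: "g = [:-a, 1:] * h"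
    by (metis poly_eq_0_iff_dvd dvdE)
  have "degree ([:b, -1:] ^ Suc n) \<le> degree [:b, -1:] * Suc n"
    by (rule degree_power_le)
  then have "degree (smult u ([:b, -1:] ^ Suc n)) \<le> Suc n"
    by (intro order.trans[OF degree_smult_le]) simp
  then have dg: "degree g \<le> Suc n"
    unfolding g_def using Suc.prems by (intro degree_diff_le)
  have "degree h \<le> n"
  proof (cases "h = 0")
    case False
    then have "degree g = degree [:-a, 1:] + degree h"
      unfolding h by (intro degree_mult_eq) auto
    then show ?thesis using dg by simp
  qed simp
  then obtain c :: "nat \<Rightarrow> real"
    where c: "h = (\<Sum>k\<le>n. smult (c k) ([:-a, 1:] ^ k * [:b, -1:] ^ (n - k)))"
    using Suc.IH by blast
  have "f = smult u ([:b, -1:] ^ Suc n) + [:-a, 1:] * h"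
    using h by (simp add: g_def algebra_simps)
  also have "[:-a, 1:] * h =
      (\<Sum>k\<le>n. smult (c k) ([:-a, 1:] ^ Suc k * [:b, -1:] ^ (Suc n - Suc k)))"
    unfolding c sum_distrib_left
    by (intro sum.cong) (simp_all only: mult_smult_right power_Suc mult.assoc diff_Suc_Suc)
  also have "smult u ([:b, -1:] ^ Suc n) + \<dots> =
      (\<Sum>k\<le>Suc n. smult (case k of 0 \<Rightarrow> u | Suc j \<Rightarrow> c j)
         ([:-a, 1:] ^ k * [:b, -1:] ^ (Suc n - k)))"
    by (subst sum.atMost_Suc_shift) (simp only: nat.case power_0 mult_1_left diff_zero)
  finally show ?case by (rule exI[of _ "case_nat u c"])
qed

lemma scaled_bernstein_independent:
  fixes c :: "nat \<Rightarrow> real"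
  assumes "a < b" "(\<Sum>k\<le>n. smult (c k) ([:-a, 1:] ^ k * [:b, -1:] ^ (n - k))) = 0" "k \<le> n"
  shows "c k = 0"
  using assms(2,3)
proof (induction n arbitrary: c k)
  case 0
  then show ?case by simp
next
  case (Suc n)
  let ?h = "\<Sum>k\<le>n. smult (c (Suc k)) ([:-a, 1:] ^ k * [:b, -1:] ^ (n - k))"
  have "[:-a, 1:] * ?h =
      (\<Sum>k\<le>n. smult (c (Suc k)) ([:-a, 1:] ^ Suc k * [:b, -1:] ^ (Suc n - Suc k)))"
    unfolding sum_distrib_left
    by (intro sum.cong) (simp_all only: mult_smult_right power_Suc mult.assoc diff_Suc_Suc)
  then have eq: "smult (c 0) ([:b, -1:] ^ Suc n) + [:-a, 1:] * ?h = 0"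
    using Suc.prems(1)
    by (subst (asm) sum.atMost_Suc_shift) (simp only: power_0 mult_1_left diff_zero)
  then have "poly (smult (c 0) ([:b, -1:] ^ Suc n) + [:-a, 1:] * ?h) a = 0"
    by simp
  then have c0: "c 0 = 0"
    using assms(1) by simp
  then have "[:-a, 1:] * ?h = 0"
    using eq by simp
  moreover have "[:-a, 1:] \<noteq> 0"
    by simp
  ultimately have "?h = 0"
    unfolding mult_eq_0_iff by blast
  then show ?case
    using Suc.IH[of "\<lambda>k. c (Suc k)"] Suc.prems(2) c0 by (cases k) auto
qed

lemma ex1_bernstein_coord:
  assumes "a < b" "degree f \<le> n"
  shows "\<exists>!c. (\<forall>k>n. c k = 0) \<and> f = (\<Sum>k\<le>n. smult (c k) (bernstein_basis a b n k))"
proof -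
  let ?w = "\<lambda>k. real (n choose k) / (b - a) ^ n"
  have w: "?w k \<noteq> 0" if "k \<le> n" for k
    using assms(1) that by simp
  obtain c :: "nat \<Rightarrow> real"
    where c: "f = (\<Sum>k\<le>n. smult (c k) ([:-a, 1:] ^ k * [:b, -1:] ^ (n - k)))"
    using scaled_bernstein_exists[OF assms] by blast
  show ?thesis
  proof (rule ex1I[of _ "\<lambda>k. if k \<le> n then c k / ?w k else 0"], goal_cases)
    case 1
    have "f = (\<Sum>k\<le>n. smult (if k \<le> n then c k / ?w k else 0) (bernstein_basis a b n k))"
      unfolding c bernstein_basis_def using w by (intro sum.cong) auto
    then show ?case by auto
  next
    case (2 d)
    then have "(\<Sum>k\<le>n. smult (d k * ?w k - c k) ([:-a, 1:] ^ k * [:b, -1:] ^ (n - k))) = 0"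
      using c by (simp add: bernstein_basis_def smult_diff_left sum_subtractf)
    then have "d k * ?w k - c k = 0" if "k \<le> n" for k
      by (rule scaled_bernstein_independent[OF assms(1) _ that])
    then show ?case
      using 2 w by (intro ext) (auto simp: field_simps)
  qed
qed

lemma bernstein_coord_sum:
  assumes "a < b" "degree f \<le> n"
  shows "f = (\<Sum>k\<le>n. smult (bernstein_coord a b n f k) (bernstein_basis a b n k))"
  using theI'[OF ex1_bernstein_coord[OF assms]] unfolding bernstein_coord_def by blast

end

theory Submission
  imports Defs
begin

text \<open>
  After the substitution \<open>x = a + (b - a) t\<close> the interval is \<open>[0, 1]\<close>, and the \<open>k\<close>-th coordinate of
  \<open>F(t) = \<Sum>\<^sub>j \<alpha>\<^sub>j t\<^sup>j\<close> in degree \<open>n\<close> is \<open>\<gamma> = \<Sum>\<^sub>j \<alpha>\<^sub>j (k choose j) / (n choose j)\<close>. The difficulty is at the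
  endpoints, where the derivative may vanish: the crude estimate \<open>\<gamma> - F(k/n) = O(1/n)\<close> is then
  useless, since inverting \<open>F\<close> amplifies the error without bound.

  Let \<open>F'\<close> vanish to order \<open>p\<close> at \<open>0\<close>, so that \<open>F' \<ge> c t\<^sup>p\<close> on \<open>[0, 3/4]\<close>
  (\<open>pderiv_pos_factor_at_0\<close>). Then \<open>\<alpha>\<^sub>j = 0\<close> for \<open>1 \<le> j \<le> p\<close>, and since
  \<open>(k choose j) / (n choose j)\<close> differs from \<open>(k/n)\<^sup>j\<close> by at most a multiple of \<open>(k/n)\<^sup>j\<^sup>-\<^sup>1 / n\<close>,
  the error carries the same weight as the derivative:
  \<open>\<bar>\<gamma> - F(x)\<bar> \<le> (C/n) x\<^sup>p\<close> for \<open>x = k/n\<close> (\<open>power_to_bernstein_approx\<close>).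
  Moving the argument by \<open>\<delta> = K/n\<close> with \<open>K\<close> large changes \<open>F\<close> by more than this, so for \<open>x \<le> 1/2\<close>
  the value \<open>\<gamma>\<close> lies between \<open>F(x - \<delta>)\<close> and \<open>F(x + \<delta>)\<close> and the intermediate value theorem gives the
  preimage. If \<open>x < \<delta>\<close>, the point \<open>x - \<delta>\<close> is replaced by \<open>0\<close>; there
  \<open>F(0) \<le> \<gamma>\<close> because the lowest nonconstant term, with \<open>\<alpha>\<^sub>p\<^sub>+\<^sub>1 > 0\<close>, dominates
  (\<open>power_to_bernstein_ge_at_0\<close>). The half \<open>x \<ge> 1/2\<close> follows by applying this to \<open>-F(1 - t)\<close>.
  The membership \<open>\<gamma> \<in> [F(0), F(1)]\<close> comes for free, as \<open>\<gamma>\<close> is exhibited as a value of \<open>F\<close>.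
\<close>

section \<open>Bernstein coordinates from power coefficients\<close>

text \<open>
  The coordinate with index \<open>k\<close> of \<open>F\<close> in the degree \<open>n\<close> Bernstein basis of \<open>[0, 1]\<close>, computed from
  the coefficients of \<open>F\<close>. It is meaningful for \<open>degree F \<le> n\<close> and \<open>k \<le> n\<close>; terms with \<open>k < j\<close> vanish.
\<close>

definition power_to_bernstein :: "real poly \<Rightarrow> nat \<Rightarrow> nat \<Rightarrow> real" where
  "power_to_bernstein F n k =
     (\<Sum>j\<le>degree F. coeff F j * (real (k choose j) / real (n choose j)))"

lemma bernstein_coord_eqI:
  assumes "a < b" "degree f \<le> n" "k \<le> n"
    and eq: "\<And>x. poly f x = (\<Sum>k\<le>n. c k * poly (bernstein_basis a b n k) x)"
  shows "bernstein_coord a b n f k = c k"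
proof -
  let ?c = "\<lambda>k. if k \<le> n then c k else 0"
  have "poly f = poly (\<Sum>k\<le>n. smult (?c k) (bernstein_basis a b n k))"
    using eq by (auto simp: poly_sum)
  then have "f = (\<Sum>k\<le>n. smult (?c k) (bernstein_basis a b n k))"
    by (simp only: poly_eq_poly_eq_iff)
  then have "bernstein_coord a b n f = ?c"
    unfolding bernstein_coord_def
    by (intro the1_equality[OF ex1_bernstein_coord[OF assms(1,2)]]) auto
  then show ?thesis using assms(3) by simp
qed

lemma power_bernstein_expansion:
  fixes t :: real
  assumes "j \<le> n"
  shows "(\<Sum>k\<le>n. real (k choose j) / real (n choose j) * (real (n choose k) * (t ^ k * (1 - t) ^ (n - k)))) = t ^ j"
proof -
  have "(\<Sum>k\<le>n. real (k choose j) / real (n choose j) * (real (n choose k) * (t ^ k * (1 - t) ^ (n - k))))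
      = (\<Sum>k\<in>{j..n}. real (k choose j) / real (n choose j) * (real (n choose k) * (t ^ k * (1 - t) ^ (n - k))))"
    by (rule sum.mono_neutral_right) auto
  also have "\<dots> = (\<Sum>k\<in>{j..n}. t ^ j * (real ((n - j) choose (k - j)) * t ^ (k - j) * (1 - t) ^ (n - k)))"
  proof (rule sum.cong[OF refl])
    fix k assume k: "k \<in> {j..n}"
    have "real (n choose k) * real (k choose j) = real (n choose j) * real ((n - j) choose (k - j))"
      using k choose_mult[of j k n] by (metis atLeastAtMost_iff of_nat_mult)
    moreover have "real (n choose j) \<noteq> 0" using assms by simp
    ultimately have "real (k choose j) / real (n choose j) * real (n choose k) = real ((n - j) choose (k - j))"
      by (simp add: field_simps)
    moreover have "t ^ k = t ^ j * t ^ (k - j)"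
      using k by (simp flip: power_add)
    ultimately have "real (k choose j) / real (n choose j) * real (n choose k) * (t ^ k * (1 - t) ^ (n - k))
        = real ((n - j) choose (k - j)) * (t ^ j * t ^ (k - j) * (1 - t) ^ (n - k))"
      by (simp only:)
    then show "real (k choose j) / real (n choose j) * (real (n choose k) * (t ^ k * (1 - t) ^ (n - k)))
        = t ^ j * (real ((n - j) choose (k - j)) * t ^ (k - j) * (1 - t) ^ (n - k))"
      by (simp only: mult_ac)
  qed
  also have "\<dots> = (\<Sum>i\<le>n - j. t ^ j * (real ((n - j) choose i) * t ^ i * (1 - t) ^ (n - j - i)))"
    using assms
    by (intro sum.reindex_bij_witness[of _ "\<lambda>i. i + j" "\<lambda>k. k - j"]) (auto simp: add.commute)
  also have "\<dots> = t ^ j * (t + (1 - t)) ^ (n - j)"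
    unfolding binomial_ring sum_distrib_left ..
  finally show ?thesis by simp
qed

lemma poly_eq_power_to_bernstein:
  assumes "degree F \<le> n"
  shows "poly F t = (\<Sum>k\<le>n. power_to_bernstein F n k * (real (n choose k) * (t ^ k * (1 - t) ^ (n - k))))"
proof -
  have "poly F t = (\<Sum>j\<le>degree F. coeff F j * t ^ j)"
    by (rule poly_altdef)
  also have "\<dots> = (\<Sum>j\<le>degree F. coeff F j * (\<Sum>k\<le>n. real (k choose j) / real (n choose j) *
      (real (n choose k) * (t ^ k * (1 - t) ^ (n - k)))))"
    using assms by (intro sum.cong refl, subst power_bernstein_expansion) auto
  also have "\<dots> = (\<Sum>k\<le>n. \<Sum>j\<le>degree F. coeff F j * (real (k choose j) / real (n choose j) *
      (real (n choose k) * (t ^ k * (1 - t) ^ (n - k)))))"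
    unfolding sum_distrib_left by (rule sum.swap)
  also have "\<dots> = (\<Sum>k\<le>n. power_to_bernstein F n k * (real (n choose k) * (t ^ k * (1 - t) ^ (n - k))))"
    unfolding power_to_bernstein_def sum_distrib_right by (simp only: mult.assoc)
  finally show ?thesis .
qed

lemma bernstein_coord_conv_power:
  assumes ab: "a < b" and deg: "degree f \<le> n" and "k \<le> n"
  shows "bernstein_coord a b n f k = power_to_bernstein (pcompose f [:a, b - a:]) n k"
proof (rule bernstein_coord_eqI[OF assms])
  fix x
  let ?F = "pcompose f [:a, b - a:]" and ?t = "(x - a) / (b - a)"
  have "degree ?F \<le> n"
    using ab deg by (simp add: degree_pcompose)
  moreover have "poly f x = poly ?F ?t"
    using ab by (simp add: poly_pcompose)
  moreover have "?t ^ k * (1 - ?t) ^ (n - k) = (x - a) ^ k * (b - x) ^ (n - k) / (b - a) ^ n"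
    if "k \<le> n" for k
  proof -
    have "1 - ?t = (b - x) / (b - a)"
      using ab by (simp add: field_simps)
    moreover have "(b - a) ^ n = (b - a) ^ k * (b - a) ^ (n - k)"
      using that by (simp flip: power_add)
    ultimately show ?thesis by (simp add: power_divide)
  qed
  ultimately show "poly f x = (\<Sum>k\<le>n. power_to_bernstein ?F n k * poly (bernstein_basis a b n k) x)"
    by (simp add: poly_eq_power_to_bernstein poly_bernstein_basis)
qed

lemma power_to_bernstein_reflect:
  assumes deg: "degree F \<le> n" and "k \<le> n"
  shows "power_to_bernstein (- pcompose F [:1, -1:]) n k = - power_to_bernstein F n (n - k)"
proof -
  let ?G = "- pcompose F [:1, -1:]"
  have dG: "degree ?G \<le> n" using deg by (simp add: degree_pcompose)
  have "bernstein_coord 0 1 n ?G k = - power_to_bernstein F n (n - k)"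
  proof (rule bernstein_coord_eqI[OF _ dG \<open>k \<le> n\<close>])
    fix x :: real
    have "poly ?G x = - poly F (1 - x)"
      by (simp add: poly_pcompose)
    also have "\<dots> = (\<Sum>k\<le>n. - power_to_bernstein F n k * (real (n choose k) * ((1 - x) ^ k * x ^ (n - k))))"
      using poly_eq_power_to_bernstein[OF deg, of "1 - x"] by (simp add: sum_negf)
    also have "\<dots> = (\<Sum>k\<le>n. - power_to_bernstein F n (n - k) * (real (n choose (n - k)) * ((1 - x) ^ (n - k) * x ^ (n - (n - k)))))"
      by (rule sum.reindex_bij_witness[of _ "\<lambda>k. n - k" "\<lambda>k. n - k"]) auto
    also have "\<dots> = (\<Sum>k\<le>n. - power_to_bernstein F n (n - k) * poly (bernstein_basis 0 1 n k) x)"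
      by (rule sum.cong) (auto simp: poly_bernstein_basis mult_ac simp flip: binomial_symmetric)
    finally show "poly ?G x = (\<Sum>k\<le>n. - power_to_bernstein F n (n - k) * poly (bernstein_basis 0 1 n k) x)" .
  qed simp
  moreover have "pcompose ?G [:0, 1 - 0:] = ?G"
    by (simp add: pcompose_idR)
  ultimately show ?thesis
    using bernstein_coord_conv_power[of 0 1 ?G n k] dG \<open>k \<le> n\<close> by simp
qed

section \<open>Ratios of binomial coefficients\<close>

text \<open>
  The factor is written with real subtraction, so that the recursion also holds for \<open>k \<le> j\<close>:
  for \<open>k = j\<close> the factor is zero, for \<open>k < j\<close> both binomial coefficients are.
\<close>

lemma binomial_ratio_Suc:
  assumes "j < n"
  shows "real (k choose Suc j) / real (n choose Suc j)
    = real (k choose j) / real (n choose j) * ((real k - real j) / (real n - real j))"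
proof -
  have step: "real (l choose Suc j) = real (l choose j) * (real l - real j) / real (Suc j)" for l
  proof (cases "j \<le> l")
    case True
    have "Suc j * (l choose Suc j) = (l - j) * (l choose j)"
      using binomial_absorption[of j l] binomial_absorb_comp[of l j] by simp
    then have "real (Suc j) * real (l choose Suc j) = (real l - real j) * real (l choose j)"
      using True by (metis of_nat_diff of_nat_mult)
    then show ?thesis by (simp add: field_simps del: binomial_Suc_Suc)
  qed (simp add: binomial_eq_0)
  show ?thesis unfolding step by simp
qed

lemma binomial_ratio_step_le:
  assumes "j < n" "k \<le> n"
  shows "(real k - real j) / (real n - real j) \<le> real k / real n"
proof -
  have "real j * real k \<le> real j * real n" using assms by (intro mult_left_mono) auto
  then show ?thesis using assms by (simp add: field_simps)
qed

lemma binomial_ratio_antimono: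
  assumes "i < j" "j \<le> n" "k \<le> n"
  shows "real (k choose j) / real (n choose j)
     \<le> real (k choose i) / real (n choose i) * (real k / real n)"
  using assms(1,2)
proof (induction j)
  case (Suc j)
  let ?w = "\<lambda>j. real (k choose j) / real (n choose j)"
  have "?w (Suc j) \<le> ?w j * (real k / real n)"
    unfolding binomial_ratio_Suc[OF Suc_le_lessD[OF Suc.prems(2)]]
    using Suc.prems assms(3) by (intro mult_left_mono binomial_ratio_step_le) auto
  show ?case
  proof (cases "i = j")
    case True
    then show ?thesis using \<open>?w (Suc j) \<le> ?w j * (real k / real n)\<close> by simp
  next
    case False
    have "?w j * (real k / real n) \<le> ?w j * 1"
      using assms(3) by (intro mult_left_mono) (auto simp: divide_le_eq_1)
    also have "?w j \<le> ?w i * (real k / real n)"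
      using Suc False by simp
    finally show ?thesis using \<open>?w (Suc j) \<le> ?w j * (real k / real n)\<close> by simp
  qed
qed simp

text \<open>
  The power of \<open>k/n\<close> in the error bound is what makes the estimate usable near \<open>0\<close>. The exponents
  are shifted by one to avoid \<open>j - 1\<close>.
\<close>

lemma binomial_ratio_approx:
  assumes "2 * j \<le> n" "k \<le> n"
  shows "0 \<le> (real k / real n) ^ Suc j - real (k choose Suc j) / real (n choose Suc j) \<and>
     (real k / real n) ^ Suc j - real (k choose Suc j) / real (n choose Suc j)
       \<le> real (Suc j * j) / real n * (real k / real n) ^ j"
  using assms(1)
proof (induction j)
  case 0
  then show ?case by simp
next
  case (Suc j)
  define x where "x = real k / real n"
  define w where "w j = real (k choose j) / real (n choose j)" for j
  define e where "e = x - (real k - real (Suc j)) / (real n - real (Suc j))"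
  define D where "D = x ^ Suc j - w (Suc j)"
  have n: "Suc j < n" using Suc.prems by simp
  have x0: "0 \<le> x" and w0: "0 \<le> w (Suc j)" by (simp_all add: x_def w_def)
  have D: "0 \<le> D" "D \<le> real (Suc j * j) / real n * x ^ j"
    using Suc by (simp_all add: D_def x_def w_def)
  have e0: "0 \<le> e"
    using binomial_ratio_step_le[OF n assms(2)] by (simp add: e_def x_def)
  have e1: "e \<le> 2 * real (Suc j) / real n"
  proof -
    have "e = real (Suc j) * (real n - real k) / (real n * (real n - real (Suc j)))"
      using n by (simp add: e_def x_def field_simps)
    also have "\<dots> \<le> real (Suc j) * real n / (real n * (real n / 2))"
      using n assms(2) Suc.prems by (intro frac_le mult_left_mono mult_nonneg_nonneg mult_pos_pos) auto
    also have "\<dots> = 2 * real (Suc j) / real n"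
      using n by simp
    finally show ?thesis .
  qed
  have "w (Suc (Suc j)) = w (Suc j) * (x - e)"
    unfolding w_def binomial_ratio_Suc[OF n] by (simp add: e_def)
  then have eq: "x ^ Suc (Suc j) - w (Suc (Suc j)) = x * D + w (Suc j) * e"
    by (simp add: D_def algebra_simps)
  have "x * D \<le> x * (real (Suc j * j) / real n * x ^ j)"
    using D x0 by (intro mult_left_mono)
  moreover have "w (Suc j) * e \<le> x ^ Suc j * (2 * real (Suc j) / real n)"
    using D(1) e0 e1 x0 w0 by (intro mult_mono) (auto simp: D_def)
  ultimately have "x * D + w (Suc j) * e
      \<le> x * (real (Suc j * j) / real n * x ^ j) + x ^ Suc j * (2 * real (Suc j) / real n)"
    by (rule add_mono)
  also have "\<dots> = real (Suc (Suc j) * Suc j) / real n * x ^ Suc j"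
  proof -
    have "real (Suc j * j) / real n + 2 * real (Suc j) / real n = real (Suc (Suc j) * Suc j) / real n"
      by (simp add: algebra_simps flip: add_divide_distrib)
    then show ?thesis
      by (simp only: power_Suc mult_ac flip: distrib_left)
  qed
  finally have "x * D + w (Suc j) * e \<le> real (Suc (Suc j) * Suc j) / real n * x ^ Suc j" .
  moreover have "0 \<le> x * D + w (Suc j) * e"
    using x0 w0 e0 D(1) by simp
  ultimately show ?case
    using eq unfolding x_def w_def by metis
qed

section \<open>Coordinates near an endpoint\<close>

text \<open>
  If \<open>F - F(0)\<close> vanishes at \<open>0\<close> to order above \<open>p\<close>, the distance of the coordinate from the value
  at \<open>k/n\<close> is of order \<open>(k/n)\<^sup>p / n\<close>.
\<close>

lemma power_to_bernstein_approx:
  assumes deg: "2 * degree F \<le> n" and k: "k \<le> n"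
    and zero: "\<And>j. 1 \<le> j \<Longrightarrow> j \<le> p \<Longrightarrow> coeff F j = 0"
  shows "\<bar>power_to_bernstein F n k - poly F (real k / real n)\<bar>
    \<le> (\<Sum>j\<le>degree F. \<bar>coeff F j\<bar> * real (j * j)) / real n * (real k / real n) ^ p"
proof -
  let ?x = "real k / real n"
  have x: "0 \<le> ?x" "?x \<le> 1" using k by (auto simp: divide_le_eq_1)
  have "\<bar>power_to_bernstein F n k - poly F ?x\<bar>
      = \<bar>\<Sum>j\<le>degree F. coeff F j * (real (k choose j) / real (n choose j) - ?x ^ j)\<bar>"
    by (simp add: power_to_bernstein_def poly_altdef sum_subtractf right_diff_distrib)
  also have "\<dots> \<le> (\<Sum>j\<le>degree F. \<bar>coeff F j * (real (k choose j) / real (n choose j) - ?x ^ j)\<bar>)"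
    by (rule sum_abs)
  also have "\<dots> \<le> (\<Sum>j\<le>degree F. \<bar>coeff F j\<bar> * real (j * j) / real n * ?x ^ p)"
  proof (rule sum_mono)
    fix j assume j: "j \<in> {..degree F}"
    consider "j = 0" | "1 \<le> j" "j \<le> p" | i where "j = Suc i" "p \<le> i"
      by (metis One_nat_def Suc_le_eq not_gr_zero not_less_eq_eq old.nat.exhaust)
    then show "\<bar>coeff F j * (real (k choose j) / real (n choose j) - ?x ^ j)\<bar>
        \<le> \<bar>coeff F j\<bar> * real (j * j) / real n * ?x ^ p"
    proof cases
      case 3
      have "\<bar>real (k choose j) / real (n choose j) - ?x ^ j\<bar> \<le> real (Suc i * i) / real n * ?x ^ i"
        using binomial_ratio_approx[of i n k] deg k j unfolding 3 by auto
      also have "\<dots> \<le> real (j * j) / real n * ?x ^ p"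
        using x 3 by (intro mult_mono divide_right_mono power_decreasing) auto
      finally show ?thesis
        unfolding abs_mult using mult_left_mono[OF _ abs_ge_zero, of _ _ "coeff F j"] by fastforce
    qed (auto simp: zero)
  qed
  also have "\<dots> = (\<Sum>j\<le>degree F. \<bar>coeff F j\<bar> * real (j * j)) / real n * ?x ^ p"
    by (simp add: sum_distrib_right sum_divide_distrib)
  finally show ?thesis .
qed

text \<open>
  For small \<open>k/n\<close> the term with index \<open>p + 1\<close> outweighs all later ones, because each later
  binomial ratio is at most \<open>k/n\<close> times the one with index \<open>p + 1\<close>.
\<close>

lemma power_to_bernstein_ge_at_0:
  assumes deg: "degree F \<le> n" and k: "k \<le> n"
    and zero: "\<And>j. 1 \<le> j \<Longrightarrow> j \<le> p \<Longrightarrow> coeff F j = 0"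
    and small: "(\<Sum>j\<le>degree F. \<bar>coeff F j\<bar>) * (real k / real n) \<le> coeff F (Suc p)"
    and p: "Suc p \<le> degree F"
  shows "poly F 0 \<le> power_to_bernstein F n k"
proof -
  define w where "w j = real (k choose j) / real (n choose j)" for j
  let ?x = "real k / real n" 
  define J where "J = {..degree F} - {0, Suc p}"
  have J: "finite J" "0 \<notin> J" "Suc p \<notin> J" "{..degree F} = insert 0 (insert (Suc p) J)"
    using p by (auto simp: J_def)
  have w0: "0 \<le> w j" for j by (simp add: w_def)
  have "- (\<Sum>j\<in>J. coeff F j * w j) \<le> (\<Sum>j\<in>J. \<bar>coeff F j\<bar> * (w (Suc p) * ?x))"
    unfolding sum_negf[symmetric]
  proof (rule sum_mono)
    fix j assume j: "j \<in> J"
    show "- (coeff F j * w j) \<le> \<bar>coeff F j\<bar> * (w (Suc p) * ?x)"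
    proof (cases "j \<le> p")
      case True
      then show ?thesis using j zero by (simp add: J_def)
    next
      case False
      then have "w j \<le> w (Suc p) * ?x"
        unfolding w_def using j k deg by (intro binomial_ratio_antimono) (auto simp: J_def)
      then have "\<bar>coeff F j\<bar> * w j \<le> \<bar>coeff F j\<bar> * (w (Suc p) * ?x)"
        by (intro mult_left_mono) auto
      moreover have "- (coeff F j * w j) \<le> \<bar>coeff F j\<bar> * w j"
        using w0[of j] by (metis abs_ge_minus_self mult_minus_left mult_right_mono)
      ultimately show ?thesis by linarith
    qed
  qed
  also have "\<dots> = (\<Sum>j\<in>J. \<bar>coeff F j\<bar>) * (w (Suc p) * ?x)"
    by (rule sum_distrib_right[symmetric])
  also have "\<dots> \<le> (\<Sum>j\<le>degree F. \<bar>coeff F j\<bar>) * (w (Suc p) * ?x)"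
    using w0 by (intro mult_right_mono sum_mono2) (auto simp: J_def)
  also have "\<dots> \<le> coeff F (Suc p) * w (Suc p)"
    using mult_right_mono[OF small w0[of "Suc p"]] by (simp add: mult_ac)
  finally have "0 \<le> coeff F (Suc p) * w (Suc p) + (\<Sum>j\<in>J. coeff F j * w j)"
    by simp
  moreover have "power_to_bernstein F n k
      = coeff F 0 * w 0 + (coeff F (Suc p) * w (Suc p) + (\<Sum>j\<in>J. coeff F j * w j))"
    unfolding power_to_bernstein_def w_def[symmetric] J(4) using J(1-3) by simp
  moreover have "w 0 = 1" by (simp add: w_def)
  ultimately show ?thesis by (simp add: poly_0_coeff_0)
qed

text \<open>
  Write \<open>F' = x\<^sup>p S\<close> with \<open>S(0) \<noteq> 0\<close>. Then \<open>S\<close> is positive on \<open>[0, 3/4]\<close>, so \<open>c\<close> may be taken as its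
  minimum there. The right end \<open>3/4\<close> leaves room beyond \<open>1/2\<close> and stays away from \<open>1\<close>,
  where \<open>F'\<close> may vanish again.
\<close>

lemma pderiv_pos_factor_at_0:
  fixes F :: "real poly"
  assumes pos: "\<And>x. 0 < x \<Longrightarrow> x < 1 \<Longrightarrow> 0 < poly (pderiv F) x"
  shows "\<exists>c p. 0 < c \<and> (\<forall>x\<in>{0..3/4}. c * x ^ p \<le> poly (pderiv F) x) \<and>
    (\<forall>j\<in>{1..p}. coeff F j = 0) \<and> 0 < coeff F (Suc p)"
proof -
  have "pderiv F \<noteq> 0" using pos[of "1/2"] by auto
  define p where "p = order 0 (pderiv F)"
  obtain S where S: "pderiv F = [:0, 1:] ^ p * S" "\<not> [:0, 1:] dvd S"
    using order_decomp[OF \<open>pderiv F \<noteq> 0\<close>, of 0] by (auto simp: p_def)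
  have d: "poly (pderiv F) x = x ^ p * poly S x" for x
    by (simp add: S(1))
  have S0: "poly S 0 \<noteq> 0"
    using S(2) poly_eq_0_iff_dvd[of S 0] by simp
  have Spos: "0 < poly S x" if "0 < x" "x < 1" for x
    using pos[OF that] that by (simp add: d zero_less_mult_iff)
  have "0 \<le> poly S 0"
  proof (rule tendsto_lowerbound)
    show "(poly S \<longlongrightarrow> poly S 0) (at_right 0)"
      by (intro tendsto_intros)
    show "\<forall>\<^sub>F x in at_right 0. 0 \<le> poly S x"
      by (rule eventually_mono[OF eventually_at_right_real[of 0 1]]) (auto intro: less_imp_le Spos)
  qed simp
  then have S0: "0 < poly S 0" using S0 by simp
  have "\<exists>x\<in>{0..3/4}. \<forall>y\<in>{0..3/4}. poly S x \<le> poly S y"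
    by (intro continuous_attains_inf continuous_intros) auto
  then obtain x0 where x0: "x0 \<in> {0..3/4}" "\<And>y. y \<in> {0..3/4} \<Longrightarrow> poly S x0 \<le> poly S y"
    by blast
  have "pderiv F = monom 1 p * S"
    unfolding S(1) by (simp add: monom_altdef)
  then have cf: "real (Suc j) * coeff F (Suc j) = (if j < p then 0 else coeff S (j - p))" for j
    using coeff_pderiv[of F j] by (auto simp: coeff_monom_mult)
  have "0 < poly S x0"
    using S0 Spos[of x0] x0(1) by (cases "x0 = 0") auto
  moreover have "poly S x0 * x ^ p \<le> poly (pderiv F) x" if "x \<in> {0..3/4}" for x
    unfolding d using x0(2)[of x] that by (subst mult.commute, intro mult_left_mono) auto
  moreover have "coeff F j = 0" if "j \<in> {1..p}" for j
    using cf[of "j - 1"] that by (cases j) auto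
  moreover have "0 < coeff F (Suc p)"
    using cf[of p] S0 zero_less_mult_pos[of "real (Suc p)" "coeff F (Suc p)"]
    by (simp add: poly_0_coeff_0)
  ultimately show ?thesis by blast
qed

text \<open>
  The theorem for the indices in the left half. Giving the preimage \<open>t\<close> as a witness also yields that
  the coordinate lies in the range of \<open>F\<close>.
\<close>

lemma bernstein_preimage_near_0:
  assumes pos: "\<And>x. 0 < x \<Longrightarrow> x < 1 \<Longrightarrow> 0 < poly (pderiv F) x"
  shows "\<exists>K N. 0 < K \<and> (\<forall>n\<ge>N. \<forall>k. 2 * k \<le> n \<longrightarrow>
    (\<exists>t\<in>{0..1}. poly F t = power_to_bernstein F n k \<and> \<bar>real k / real n - t\<bar> \<le> K / real n))"
proof -
  obtain c p where c: "0 < c" and d: "\<forall>x\<in>{0..3/4}. c * x ^ p \<le> poly (pderiv F) x"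
    and zero: "\<forall>j\<in>{1..p}. coeff F j = 0" and lead: "0 < coeff F (Suc p)"
    using pderiv_pos_factor_at_0[of F] pos by metis
  have growth: "c * y ^ p * (z - y) \<le> poly F z - poly F y" if "0 \<le> y" "y \<le> z" "z \<le> 3/4" for y z
  proof (cases "y = z")
    case False
    then have "y < z" using that by simp
    from poly_MVT[OF this, of F]
    obtain u where u: "y < u" "u < z" "poly F z - poly F y = (z - y) * poly (pderiv F) u"
      by blast
    have "c * y ^ p \<le> c * u ^ p"
      using c u that by (intro mult_left_mono power_mono) auto
    also have "\<dots> \<le> poly (pderiv F) u"
      using d u that by simp
    finally have "c * y ^ p * (z - y) \<le> poly (pderiv F) u * (z - y)"
      using that by (intro mult_right_mono) auto
    then show ?thesis
      using u(3) by (simp add: mult.commute)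
  qed simp
  define C where "C = (\<Sum>j\<le>degree F. \<bar>coeff F j\<bar> * real (j * j))"
  define A where "A = (\<Sum>j\<le>degree F. \<bar>coeff F j\<bar>)"
  \<comment> \<open>\<open>K\<close> is chosen such that \<open>c (x/2)\<^sup>p (\<delta>/2) = ((C + 1)/n) x\<^sup>p\<close> for \<open>\<delta> = K/n\<close>; the first summand of
    \<open>N\<close> makes \<open>\<delta> \<le> 1/4\<close>, the second serves the case \<open>x < \<delta>\<close>.\<close>
  define K where "K = (C + 1) * 2 ^ Suc p / c"
  define N where "N = nat \<lceil>4 * K\<rceil> + nat \<lceil>K * A / coeff F (Suc p)\<rceil> + 2 * degree F + 1"
  have C0: "0 \<le> C" and A0: "0 \<le> A" by (simp_all add: C_def A_def sum_nonneg)
  have K0: "0 < K" using C0 c by (simp add: K_def)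
  have "\<exists>t\<in>{0..1}. poly F t = power_to_bernstein F n k \<and> \<bar>real k / real n - t\<bar> \<le> K / real n"
    if n: "n \<ge> N" and k: "2 * k \<le> n" for n k
  proof -
    define x where "x = real k / real n"
    define \<delta> where "\<delta> = K / real n"
    define g where "g = power_to_bernstein F n k"
    have n0: "0 < real n" and deg: "2 * degree F \<le> n" using n by (simp_all add: N_def)
    have "4 * K \<le> real n" "K * A / coeff F (Suc p) \<le> real n"
      using n unfolding N_def by linarith+
    then have \<delta>1: "\<delta> \<le> 1/4" and \<delta>A: "A * \<delta> \<le> coeff F (Suc p)"
      using n0 lead by (simp_all add: \<delta>_def field_simps)
    have \<delta>0: "0 < \<delta>" using K0 n0 by (simp add: \<delta>_def)
    have x: "0 \<le> x" "x \<le> 1/2" using k n0 by (simp_all add: x_def field_simps)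
    have err: "\<bar>g - poly F x\<bar> \<le> C / real n * x ^ p"
      unfolding g_def x_def C_def
      by (rule power_to_bernstein_approx[OF deg]) (use k zero in auto)
    have half: "C / real n * x ^ p \<le> c * (x / 2) ^ p * (\<delta> / 2)"
    proof -
      have "c * (x / 2) ^ p * (\<delta> / 2) = (C + 1) / real n * x ^ p"
        using c n0 by (simp add: \<delta>_def K_def power_divide field_simps)
      moreover have "C / real n * x ^ p \<le> (C + 1) / real n * x ^ p"
        using x n0 by (intro mult_right_mono divide_right_mono) auto
      ultimately show ?thesis by simp
    qed
    have upper: "g \<le> poly F (x + \<delta>)"
    proof -
      have "c * (x / 2) ^ p * (\<delta> / 2) \<le> c * x ^ p * \<delta>"
        using x c \<delta>0 by (intro mult_mono power_mono) auto
      also have "\<dots> \<le> poly F (x + \<delta>) - poly F x"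
        using growth[of x "x + \<delta>"] x \<delta>0 \<delta>1 by simp
      finally show ?thesis using err half by linarith
    qed
    have lower: "poly F (max 0 (x - \<delta>)) \<le> g"
    proof (cases "\<delta> \<le> x")
      case True
      \<comment> \<open>Only the half \<open>[x - \<delta>/2, x]\<close> is used, since \<open>x - \<delta>/2 \<ge> x/2\<close> keeps the derivative comparable
        with its bound at \<open>x\<close>; at \<open>x - \<delta>\<close> it may vanish.\<close>
      have "c * (x / 2) ^ p * (\<delta> / 2) \<le> c * (x - \<delta> / 2) ^ p * (\<delta> / 2)"
        using x c \<delta>0 True by (intro mult_mono power_mono) auto
      also have "\<dots> \<le> poly F x - poly F (x - \<delta> / 2)"
        using growth[of "x - \<delta> / 2" x] x \<delta>0 True by simp
      also have "\<dots> \<le> poly F x - poly F (x - \<delta>)"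
      proof -
        have "0 \<le> c * (x - \<delta>) ^ p * (x - \<delta> / 2 - (x - \<delta>))"
          using c \<delta>0 True by simp
        also have "\<dots> \<le> poly F (x - \<delta> / 2) - poly F (x - \<delta>)"
          using growth[of "x - \<delta>" "x - \<delta> / 2"] x \<delta>0 True by simp
        finally show ?thesis by simp
      qed
      finally have "poly F (x - \<delta>) \<le> g" using err half by linarith
      then show ?thesis using True by simp
    next
      case False
      have "A * x \<le> coeff F (Suc p)"
        using mult_left_mono[OF less_imp_le[OF False[unfolded not_le]] A0] \<delta>A by linarith
      moreover have "Suc p \<le> degree F" using lead by (intro le_degree) simp
      ultimately have "poly F 0 \<le> g"
        unfolding g_def x_def A_def using k deg zero
        by (intro power_to_bernstein_ge_at_0[of _ _ _ p]) auto
      then show ?thesis using False by simp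
    qed
    have "\<exists>t. max 0 (x - \<delta>) \<le> t \<and> t \<le> x + \<delta> \<and> poly F t = g"
      using x \<delta>0 by (intro IVT' lower upper continuous_intros) auto
    then obtain t where t: "max 0 (x - \<delta>) \<le> t" "t \<le> x + \<delta>" "poly F t = g" by blast
    then have "t \<in> {0..1}" "\<bar>x - t\<bar> \<le> \<delta>" using x \<delta>1 by auto
    with t(3) show ?thesis unfolding g_def x_def \<delta>_def by blast
  qed
  with K0 show ?thesis by blast
qed

section \<open>The whole interval\<close>

lemma bernstein_preimage_unit_interval:
  assumes pos: "\<And>x. 0 < x \<Longrightarrow> x < 1 \<Longrightarrow> 0 < poly (pderiv F) x"
  shows "\<exists>K N. 0 < K \<and> (\<forall>n\<ge>N. \<forall>k\<le>n.
    \<exists>t\<in>{0..1}. poly F t = power_to_bernstein F n k \<and> \<bar>real k / real n - t\<bar> \<le> K / real n)"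
proof -
  \<comment> \<open>Indices above \<open>n/2\<close> are treated through \<open>-F(1 - t)\<close>, again with positive derivative on \<open>(0, 1)\<close>.\<close>
  let ?G = "- pcompose F [:1, -1:]"
  obtain K1 N1 where 1: "0 < K1" "\<And>n k. n \<ge> N1 \<Longrightarrow> 2 * k \<le> n \<Longrightarrow>
      \<exists>t\<in>{0..1}. poly F t = power_to_bernstein F n k \<and> \<bar>real k / real n - t\<bar> \<le> K1 / real n"
    using bernstein_preimage_near_0[OF pos] by blast
  have "0 < poly (pderiv ?G) x" if "0 < x" "x < 1" for x
    using pos[of "1 - x"] that by (simp add: pderiv_minus pderiv_pcompose poly_pcompose pderiv_pCons)
  then obtain K2 N2 where 2: "0 < K2" "\<And>n k. n \<ge> N2 \<Longrightarrow> 2 * k \<le> n \<Longrightarrow>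
      \<exists>t\<in>{0..1}. poly ?G t = power_to_bernstein ?G n k \<and> \<bar>real k / real n - t\<bar> \<le> K2 / real n"
    using bernstein_preimage_near_0[of ?G] by blast
  have "\<exists>t\<in>{0..1}. poly F t = power_to_bernstein F n k \<and> \<bar>real k / real n - t\<bar> \<le> max K1 K2 / real n"
    if n: "n \<ge> max (max N1 N2) (degree F + 1)" and k: "k \<le> n" for n k
  proof (cases "2 * k \<le> n")
    case True
    then obtain t where "t \<in> {0..1}" "poly F t = power_to_bernstein F n k"
      "\<bar>real k / real n - t\<bar> \<le> K1 / real n"
      using 1(2)[of n k] n by auto
    moreover have "K1 / real n \<le> max K1 K2 / real n" by (intro divide_right_mono) auto
    ultimately show ?thesis by (meson order.trans)
  next
    case False
    then have "N2 \<le> n" "2 * (n - k) \<le> n" using n by auto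
    from 2(2)[OF this] obtain t where t: "t \<in> {0..1}" "poly ?G t = power_to_bernstein ?G n (n - k)"
      "\<bar>real (n - k) / real n - t\<bar> \<le> K2 / real n"
      by blast
    have "poly F (1 - t) = power_to_bernstein F n k"
      using t(2) power_to_bernstein_reflect[of F n "n - k"] n k by (simp add: poly_pcompose)
    moreover have "\<bar>real k / real n - (1 - t)\<bar> \<le> max K1 K2 / real n"
    proof -
      have "real k / real n - (1 - t) = - (real (n - k) / real n - t)"
        using n k by (simp add: of_nat_diff diff_divide_distrib)
      moreover have "K2 / real n \<le> max K1 K2 / real n" by (intro divide_right_mono) auto
      ultimately show ?thesis using t(3) by simp
    qed
    ultimately show ?thesis using t(1) by (intro bexI[of _ "1 - t"]) auto
  qed
  moreover have "0 < max K1 K2" using 1(1) by simp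
  ultimately show ?thesis by blast
qed

theorem theorem6p2:
  fixes a b :: real and f\<^sub>1 :: "real poly" and m :: nat
  assumes "a < b"
    and "strict_mono_on {a..b} (poly f\<^sub>1)"
    and "degree f\<^sub>1 = m"
    and "\<forall>x\<in>{a<..<b}. poly (pderiv f\<^sub>1) x > 0"
  shows "\<exists>n\<^sub>0::nat. n\<^sub>0 \<ge> m \<and> (\<exists>K::real. K > 0 \<and>
    (\<forall>n\<ge>n\<^sub>0. \<forall>k\<le>n.
       bernstein_coord a b n f\<^sub>1 k \<in> {poly f\<^sub>1 a..poly f\<^sub>1 b} \<and>
       \<bar>a + real k / real n * (b - a)
          - inv_into {a..b} (poly f\<^sub>1) (bernstein_coord a b n f\<^sub>1 k)\<bar> \<le> K / real n))"
proof -
  define h where "h = b - a"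
  have h: "0 < h" using assms(1) by (simp add: h_def)
  let ?F = "pcompose f\<^sub>1 [:a, h:]"
  have range: "a + h * t \<in> {a..b}" if "t \<in> {0..1}" for t
  proof -
    have "0 \<le> h * t" "h * t \<le> h * 1" using that h by (auto intro: mult_left_mono)
    then show ?thesis by (simp add: h_def)
  qed
  have "0 < poly (pderiv ?F) x" if "0 < x" "x < 1" for x
  proof -
    have "0 < h * x" "h * x < h * 1" using that h by auto
    then have "0 < poly (pderiv f\<^sub>1) (a + h * x)"
      using assms(4) by (simp add: h_def)
    then show ?thesis
      using h by (simp add: pderiv_pcompose poly_pcompose pderiv_pCons mult.commute)
  qed
  then obtain K N where K: "0 < K" "\<And>n k. n \<ge> N \<Longrightarrow> k \<le> n \<Longrightarrow>
      \<exists>t\<in>{0..1}. poly ?F t = power_to_bernstein ?F n k \<and> \<bar>real k / real n - t\<bar> \<le> K / real n"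
    using bernstein_preimage_unit_interval[of ?F] by blast
  have "bernstein_coord a b n f\<^sub>1 k \<in> {poly f\<^sub>1 a..poly f\<^sub>1 b} \<and>
      \<bar>a + real k / real n * (b - a)
         - inv_into {a..b} (poly f\<^sub>1) (bernstein_coord a b n f\<^sub>1 k)\<bar> \<le> h * K / real n"
    if n: "n \<ge> max N m" and k: "k \<le> n" for n k
  proof -
    obtain t where t: "t \<in> {0..1}" "poly ?F t = power_to_bernstein ?F n k"
      "\<bar>real k / real n - t\<bar> \<le> K / real n"
      using K(2)[of n k] n k by auto
    let ?s = "a + h * t"
    have coord: "bernstein_coord a b n f\<^sub>1 k = poly f\<^sub>1 ?s"
      using bernstein_coord_conv_power[OF assms(1), of f\<^sub>1 n k] assms(3) n k t(2)
      by (simp add: h_def poly_pcompose mult.commute)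
    have s: "?s \<in> {a..b}" using range t(1) .
    have mono: "mono_on {a..b} (poly f\<^sub>1)"
      using assms(2) by (rule strict_mono_on_imp_mono_on)
    have "poly f\<^sub>1 ?s \<in> {poly f\<^sub>1 a..poly f\<^sub>1 b}"
      using s assms(1) by (auto intro!: mono_onD[OF mono])
    moreover have "inv_into {a..b} (poly f\<^sub>1) (poly f\<^sub>1 ?s) = ?s"
      using assms(2) s by (intro inv_into_f_f strict_mono_on_imp_inj_on)
    moreover have "\<bar>a + real k / real n * (b - a) - ?s\<bar> = h * \<bar>real k / real n - t\<bar>"
    proof -
      have "a + real k / real n * (b - a) - ?s = h * (real k / real n - t)"
        by (simp add: h_def algebra_simps)
      then show ?thesis using h by (simp add: abs_mult)
    qed
    moreover have "h * \<bar>real k / real n - t\<bar> \<le> h * (K / real n)"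
      using h t(3) by (intro mult_left_mono) auto
    ultimately show ?thesis unfolding coord by simp
  qed
  moreover have "0 < h * K" using h K(1) by simp
  ultimately show ?thesis
    by (intro exI[of _ "max N m"] conjI exI[of _ "h * K"]) auto
qed

end
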